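(* There exists a Polish group of infinitesimal rank $1$ which is totally disconnected.
   Context: A Polish group is a separable topological group whose topology admits a compatible complete metric. For a topological group $G$, the infinitesimal rank $t_I(G)$ is the minimum $n\in\mathbb{N}\cup\{+\infty\}$ (with $0\in\mathbb N$, so that the trivial group has rank $0$) such that every neighborhood of the identity in $G$ contains $n$ elements $g_1,\dots,g_n$ which generate a dense subgroup of $G$. A topological group is totally disconnected if its connected components are singletons. *)

theory Defs
  imports "HOL-Analysis.Analysis" "HOL-Algebra.Generated_Groups" "HOL-Library.Extended_Nat"
begin

locale topological_group = group G for G (structure) +
  fixes T :: "'a topology"
  assumes topspace_eq_carrier: "topspace T = carrier G"
    and continuous_mult: "continuous_map (prod_topology T T) T (\<lambda>(x, y). x \<otimes> y)"
    and continuous_inv: "continuous_map T T (\<lambda>x. inv x)"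

(* Existence of a Polish group can be stated over real as the type of elements: the carrier may
   be any subset of that type, the operation and the topology are unrelated to those of the real
   line, and every Polish group has at most continuum many elements. *)
locale polish_group = topological_group +
  assumes separable: "separable_space T"
    and completely_metrizable: "completely_metrizable_space T"

(* The elements of a tuple of length n are g 0, ..., g (n - 1), repetitions being allowed;
   for n = \<infinity> the tuple is an infinite sequence. *)
definition small_topological_generators ::
    "('a, 'b) monoid_scheme \<Rightarrow> 'a topology \<Rightarrow> enat \<Rightarrow> bool" where
  "small_topological_generators G T n \<longleftrightarrow>
     (\<forall>U. U \<subseteq> topspace T \<and> \<one>\<^bsub>G\<^esub> \<in> T interior_of U \<longrightarrow>
       (\<exists>g :: nat \<Rightarrow> 'a. g ` {i. enat i < n} \<subseteq> U \<and>
          T closure_of (generate G (g ` {i. enat i < n})) = topspace T))"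

(* Inf on enat is the minimum of a nonempty set, and Inf {} = \<infinity>. *)
definition infinitesimal_rank :: "('a, 'b) monoid_scheme \<Rightarrow> 'a topology \<Rightarrow> enat" where
  "infinitesimal_rank G T = Inf {n. small_topological_generators G T n}"

definition totally_disconnected_topology :: "'a topology \<Rightarrow> bool" where
  "totally_disconnected_topology T \<longleftrightarrow>
     (\<forall>C \<in> connected_components_of T. \<exists>x. C = {x})"

end

theory Submission
  imports Defs "HOL-Number_Theory.Cong"
begin

text \<open>
The group is a proper dense subgroup of the circle \<open>\<real>/\<int>\<close> with a finer Polish topology. Write
\<open>e(x) = exp(2 \<pi> i x)\<close>, let \<open>n\<^sub>0 = 1\<close>, \<open>n\<^sub>1\<close>, \<open>n\<^sub>2\<close>, \<open>\<dots>\<close> be powers of two that grow very fast, and put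
\<open>N(x) = (\<Sum>k. \<bar>e(n\<^sub>k x) - 1\<bar>)\<close>. The points with \<open>N(x) < \<infinity>\<close> form a subgroup \<open>G\<close> of the circle, and
\<open>d(x, y) = N(x - y)\<close> is an invariant metric on it. Since \<open>n\<^sub>0 = 1\<close>, this metric is finer than that of
the circle, so a Cauchy sequence converges in the circle; applying the triangle inequality to the
partial sums of \<open>N\<close> shows that it converges for \<open>d\<close> as well (\<open>mcomplete_lac\<close>).

Arbitrarily small generators. Let \<open>t\<^sub>M = (\<Sum>i>M. 1 / n\<^sub>i)\<close>. This element tends to \<open>0\<close> in \<open>G\<close> as
\<open>M\<close> grows. Cutting the series at \<open>L > M\<close> gives \<open>t\<^sub>M = p / n\<^sub>L + t\<^sub>L\<close> with \<open>p\<close> odd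
(\<open>tail_odd_numerator\<close>). As \<open>n\<^sub>L\<close> is a power of two, \<open>p / n\<^sub>L\<close> generates all fractions \<open>a / n\<^sub>L\<close>
modulo \<open>1\<close>, with multipliers \<open>b < n\<^sub>L\<close>, and for such \<open>b\<close> the error \<open>b t\<^sub>L\<close> is still small in
\<open>G\<close> (\<open>lac_norm_mult_tail\<close>). Since every element of \<open>G\<close> is a limit of fractions with denominators
\<open>n\<^sub>L\<close> (\<open>dyadic_approximation\<close>), the multiples of every \<open>t\<^sub>M\<close> are dense
(\<open>multiples_of_tail_dense\<close>). This yields both separability and rank at most \<open>1\<close>. The rank is not \<open>0\<close>
because \<open>1/2\<close> lies in \<open>G\<close>.

Total disconnectedness. The points \<open>w\<close> of the circle with real part \<open>1/2\<close> have order \<open>6\<close>, so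
\<open>n\<^sub>k w\<close> stays away from \<open>0\<close> and they are not in \<open>G\<close>. Hence the line of complex numbers with
real part \<open>1/2\<close> cuts \<open>G\<close> into two clopen pieces. Repeated doubling moves every nonzero \<open>x\<close> across
this line (\<open>doubling_leaves_arc\<close>), while \<open>0\<close> stays where it is. Pulling the cut back along
\<open>t \<mapsto> 2\<^sup>j (t - x)\<close> therefore separates any two points of \<open>G\<close>.
\<close>

section \<open>Chord lengths on the circle\<close>

definition circle_point :: "real \<Rightarrow> complex" where
  "circle_point x = cis (2 * pi * x)"

definition chord :: "real \<Rightarrow> real" where
  "chord x = cmod (circle_point x - 1)"

lemma circle_point_add: "circle_point (x + y) = circle_point x * circle_point y"
  by (simp add: circle_point_def cis_mult distrib_left)

lemma circle_point_of_int [simp]: "circle_point (of_int m) = 1"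
  by (simp add: circle_point_def complex_eq_iff cos_int_2pin sin_int_2pin)

lemma circle_point_0 [simp]: "circle_point 0 = 1"
  by (simp add: circle_point_def)

lemma norm_circle_point [simp]: "cmod (circle_point x) = 1"
  by (simp add: circle_point_def)

lemma circle_point_of_nat_mult: "circle_point (of_nat n * x) = circle_point x ^ n"
  by (simp add: circle_point_def Complex.DeMoivre mult_ac)

lemma chord_diff: "chord (x - y) = cmod (circle_point x - circle_point y)"
proof -
  have "circle_point x - circle_point y = circle_point y * (circle_point (x - y) - 1)"
    by (simp add: circle_point_add [symmetric] right_diff_distrib)
  then show ?thesis
    by (simp add: chord_def norm_mult)
qed

lemma chord_nonneg [simp]: "0 \<le> chord x"
  by (simp add: chord_def)

lemma chord_0 [simp]: "chord 0 = 0"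
  by (simp add: chord_def)

lemma chord_minus: "chord (- x) = chord x"
  using chord_diff [of 0 x] chord_diff [of x 0] by (simp add: norm_minus_commute)

lemma chord_add_le: "chord (x + y) \<le> chord x + chord y"
proof -
  have "chord (x + y) = cmod (circle_point x - circle_point (- y))"
    using chord_diff [of x "- y"] by simp
  also have "\<dots> \<le> cmod (circle_point x - 1) + cmod (circle_point (- y) - 1)"
    using norm_triangle_ineq4 [of "circle_point x - 1" "circle_point (- y) - 1"] by simp
  finally show ?thesis
    by (metis chord_def chord_minus)
qed

lemma chord_add_of_int [simp]: "chord (x + of_int m) = chord x"
  by (simp add: chord_def circle_point_add)

lemma chord_le: "chord x \<le> 7 * \<bar>x\<bar>"
proof -
  have "chord x = 2 * \<bar>sin (2 * pi * x / 2)\<bar>"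
    using dist_exp_i_1 [of "2 * pi * x"] by (simp add: chord_def circle_point_def cis_conv_exp)
  also have "\<dots> \<le> 2 * \<bar>pi * x\<bar>"
    using abs_sin_x_le_abs_x [of "pi * x"] by (simp add: mult.commute)
  also have "\<dots> = (2 * pi) * \<bar>x\<bar>"
    by (simp add: abs_mult)
  also have "\<dots> \<le> 7 * \<bar>x\<bar>"
    using pi_less_4 pi_approx by (intro mult_right_mono) auto
  finally show ?thesis .
qed

lemma chord_eq_0_imp_Ints: 
  assumes "chord x = 0" shows "x \<in> \<int>"
proof -
  have "cos (2 * pi * x) = 1"
    using assms by (simp add: chord_def circle_point_def complex_eq_iff)
  then obtain m :: int where "2 * pi * x = of_int m * 2 * pi"
    using cos_one_2pi_int by blast
  then show ?thesis by simp
qed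

section \<open>Lacunary denominators\<close>

text \<open>Three features of these numbers matter. The exponents start at \<open>0\<close>, so that \<open>den 0 = 1\<close> and the
norm below controls the chord itself. Each term is more than the fourth power of the previous one,
which leaves room for multiplying a tail by \<open>den L\<close> and by \<open>den k\<close> and still obtaining a geometric
series in \<open>k\<close>. All terms are powers of two, so that odd numbers are invertible modulo each of them.\<close>

definition den :: "nat \<Rightarrow> nat" where
  "den k = 2 ^ (4 ^ k - 1)"

lemma den_0 [simp]: "den 0 = 1"
  by (simp add: den_def)

lemma den_Suc: "den (Suc k) = 8 * den k ^ 4"
proof -
  have "4 ^ Suc k - 1 = (3::nat) + (4 ^ k - 1) * 4"
  proof -
    have "(1::nat) \<le> 4 ^ k" by simp
    then show ?thesis by (simp add: diff_mult_distrib)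
  qed
  then show ?thesis
    by (simp add: den_def power_add power_mult)
qed

lemma den_pos [simp]: "0 < den k"
  by (simp add: den_def)

lemma den_neq_0 [simp]: "den k \<noteq> 0"
  by (simp add: den_def)

lemma den_ge_1: "1 \<le> real (den k)"
  by (simp add: Suc_leI)

lemma two_den_le_den_Suc: "2 * den k \<le> den (Suc k)"
proof -
  have "den k * 1 \<le> den k * den k ^ 3"
    by (intro mult_left_mono) (auto simp: Suc_leI)
  also have "\<dots> = den k ^ 4"
    by (simp add: eval_nat_numeral)
  finally show ?thesis by (simp add: den_Suc)
qed

lemma den_add_ge: "2 ^ i * den k \<le> den (k + i)"
proof (induction i)
  case (Suc i)
  then show ?case
    using two_den_le_den_Suc [of "k + i"] by simp
qed simp

lemma two_power_le_den: "2 ^ k \<le> den k"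
  using den_add_ge [of k 0] by simp

lemma den_dvd: "k \<le> l \<Longrightarrow> den k dvd den l"
  unfolding den_def by (intro le_imp_power_dvd diff_le_mono power_increasing) auto

lemma den_mono: "k \<le> l \<Longrightarrow> den k \<le> den l"
  using den_dvd [of k l] by (simp add: dvd_imp_le)

lemma inverse_den_tendsto_0: "(\<lambda>k. 1 / real (den k)) \<longlonglongrightarrow> 0"
proof (rule Lim_null_comparison)
  have "1 / real (den k) \<le> (1 / 2) ^ k" for k
  proof -
    have "2 ^ k \<le> real (den k)"
      using two_power_le_den by simp
    then have "1 / real (den k) \<le> 1 / 2 ^ k"
      by (intro divide_left_mono) auto
    then show ?thesis by (simp add: power_one_over)
  qed
  then show "\<forall>\<^sub>F k in sequentially. norm (1 / real (den k)) \<le> (1 / 2) ^ k"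
    by simp
  show "(\<lambda>k. (1 / 2 :: real) ^ k) \<longlonglongrightarrow> 0"
    by (rule LIMSEQ_power_zero) simp
qed

definition tail :: "nat \<Rightarrow> real" where
  "tail L = (\<Sum>i. 1 / real (den (Suc L + i)))"

lemma inverse_den_le: "1 / real (den (Suc L + i)) \<le> (1 / 2) ^ i * (1 / real (den (Suc L)))"
proof -
  have "2 ^ i * real (den (Suc L)) \<le> real (den (Suc L + i))"
    using of_nat_mono [OF den_add_ge [of i "Suc L"], where 'a = real] by simp
  then have "1 / real (den (Suc L + i)) \<le> 1 / (2 ^ i * real (den (Suc L)))"
    by (intro divide_left_mono) auto
  then show ?thesis by (simp add: power_one_over)
qed

lemma geometric_summable: "summable (\<lambda>i. (1 / 2) ^ i * (c::real))"
  by (intro summable_mult2 summable_geometric) simp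

lemma geometric_suminf: "(\<Sum>i. (1 / 2) ^ i * c) = 2 * (c::real)"
  by (subst suminf_mult2 [symmetric]) (auto simp: suminf_geometric summable_geometric)

lemma tail_summable: "summable (\<lambda>i. 1 / real (den (Suc L + i)))"
  by (rule summable_comparison_test' [OF geometric_summable [of "1 / real (den (Suc L))"], where N = 0])
     (use inverse_den_le [of L] in auto)

lemma tail_nonneg: "0 \<le> tail L"
  unfolding tail_def by (intro suminf_nonneg tail_summable) simp

lemma tail_le: "tail L \<le> 2 / real (den (Suc L))"
proof -
  have "tail L \<le> (\<Sum>i. (1 / 2) ^ i * (1 / real (den (Suc L))))"
    unfolding tail_def by (intro suminf_le inverse_den_le tail_summable geometric_summable)
  then show ?thesis unfolding geometric_suminf by simp
qed

lemma tail_Suc: "tail L = 1 / real (den (Suc L)) + tail (Suc L)"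
  using suminf_split_head [OF tail_summable, of L] by (simp add: tail_def)

text \<open>The last summand of the truncated series contributes \<open>1\<close> to the numerator, and each earlier one
contributes a quotient of two different denominators, which is even.\<close>

lemma tail_odd_numerator:
  assumes "M < L"
  shows "\<exists>p::nat. odd p \<and> tail M = real p / real (den L) + tail L"
  using assms
proof (induction L)
  case (Suc L)
  show ?case
  proof (cases "M = L")
    case True
    then show ?thesis using tail_Suc [of L] by (intro exI [of _ 1]) simp
  next
    case False
    with Suc obtain p where p: "tail M = real p / real (den L) + tail L"
      by auto
    have "real p / real (den L) + 1 / real (den (Suc L))
        = real (p * (8 * den L ^ 3) + 1) / real (den (Suc L))"
      by (simp add: den_Suc field_simps eval_nat_numeral)
    then show ?thesis
      using p tail_Suc [of L] by (intro exI [of _ "p * (8 * den L ^ 3) + 1"]) simp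
  qed
qed simp

section \<open>The lacunary norm\<close>

text \<open>The norm is defined on real numbers, on which it is invariant under integer translations, so that
arithmetic needs no representatives modulo \<open>1\<close>. These enter only with the group itself.\<close>

definition lac_set :: "real set" where
  "lac_set = {x. summable (\<lambda>k. chord (real (den k) * x))}"

definition lac_norm :: "real \<Rightarrow> real" where
  "lac_norm x = (\<Sum>k. chord (real (den k) * x))"

lemma lac_set_summable: "x \<in> lac_set \<Longrightarrow> summable (\<lambda>k. chord (real (den k) * x))"
  by (simp add: lac_set_def)

lemma lac_norm_nonneg: "x \<in> lac_set \<Longrightarrow> 0 \<le> lac_norm x"
  unfolding lac_norm_def by (intro suminf_nonneg lac_set_summable) auto

lemma lac_set_minus [simp]: "- x \<in> lac_set \<longleftrightarrow> x \<in> lac_set"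
  by (simp add: lac_set_def chord_minus)

lemma lac_norm_minus: "lac_norm (- x) = lac_norm x"
  by (simp add: lac_norm_def chord_minus)

lemma lac_set_add:
  assumes "x \<in> lac_set" "y \<in> lac_set"
  shows "x + y \<in> lac_set" and "lac_norm (x + y) \<le> lac_norm x + lac_norm y"
proof -
  have le: "chord (real (den k) * (x + y)) \<le> chord (real (den k) * x) + chord (real (den k) * y)" for k
    using chord_add_le by (simp add: distrib_left)
  have s: "summable (\<lambda>k. chord (real (den k) * x) + chord (real (den k) * y))"
    by (intro summable_add lac_set_summable assms)
  show in_set: "x + y \<in> lac_set"
    unfolding lac_set_def
    by (simp, rule summable_comparison_test' [OF s, where N = 0]) (use le in auto)
  show "lac_norm (x + y) \<le> lac_norm x + lac_norm y"
    using suminf_le [OF le lac_set_summable [OF in_set] s]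
      suminf_add [OF assms [THEN lac_set_summable]] by (simp add: lac_norm_def)
qed

lemma lac_set_diff: "x \<in> lac_set \<Longrightarrow> y \<in> lac_set \<Longrightarrow> x - y \<in> lac_set"
  using lac_set_add(1) [of x "- y"] by simp

lemma chord_den_add_of_int [simp]:
  "chord (real (den k) * (x + of_int m)) = chord (real (den k) * x)"
  using chord_add_of_int [of "real (den k) * x" "int (den k) * m"] by (simp add: distrib_left)

lemma lac_set_add_of_int [simp]: "x + of_int m \<in> lac_set \<longleftrightarrow> x \<in> lac_set"
  by (simp add: lac_set_def)

lemma lac_norm_add_of_int [simp]: "lac_norm (x + of_int m) = lac_norm x"
  by (simp add: lac_norm_def)

lemma lac_set_of_int [simp]: "of_int m \<in> lac_set" and lac_norm_of_int [simp]: "lac_norm (of_int m) = 0"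
  using lac_set_add_of_int [of 0 m] lac_norm_add_of_int [of 0 m]
  by (simp_all add: lac_set_def lac_norm_def)

lemma lac_set_of_nat_mult: "x \<in> lac_set \<Longrightarrow> real n * x \<in> lac_set"
proof (induction n)
  case 0
  then show ?case using lac_set_of_int [of 0] by simp
next
  case (Suc n)
  then show ?case using lac_set_add(1) [of x "real n * x"] by (simp add: distrib_right)
qed

lemma chord_le_lac_norm:
  assumes "x \<in> lac_set" shows "chord x \<le> lac_norm x"
  using sum_le_suminf [OF lac_set_summable [OF assms], of "{0}"] by (simp add: lac_norm_def)

lemma lac_norm_eq_0_iff:
  assumes "x \<in> lac_set" shows "lac_norm x = 0 \<longleftrightarrow> x \<in> \<int>"
proof
  assume "lac_norm x = 0"
  then show "x \<in> \<int>"
    using chord_le_lac_norm [OF assms] by (intro chord_eq_0_imp_Ints antisym) auto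
qed (auto elim!: Ints_cases)

text \<open>Bounds of this shape keep track of summability and of the size of the norm at the same time.\<close>

lemma lac_norm_le_geometric:
  assumes "\<And>k. chord (real (den k) * x) \<le> (1 / 2) ^ k * c"
  shows "x \<in> lac_set" and "lac_norm x \<le> 2 * c"
proof -
  show "x \<in> lac_set"
    unfolding lac_set_def
    by (simp, rule summable_comparison_test' [OF geometric_summable, where N = 0]) (use assms in auto)
  then show "lac_norm x \<le> 2 * c"
    using suminf_le [OF assms lac_set_summable geometric_summable]
    by (simp add: lac_norm_def geometric_suminf)
qed

section \<open>Density of the multiples of a small element\<close>

text \<open>This is where the growth of the denominators is used. Of the four factors \<open>den j\<close> in \<open>den (Suc j)\<close>,
two cancel against the left-hand side, one pays for \<open>den L\<close>, and one pays for \<open>2 ^ k\<close>.\<close>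

lemma lacunary_estimate:
  assumes "k \<le> j" "L \<le> j"
  shows "real (den j) * (real (den j) / real (den (Suc j))) \<le> (1 / 2) ^ k * (1 / real (den L)) / 8"
proof -
  have "real (den j) * (real (den j) / real (den (Suc j))) = 1 / (real (den j) * real (den j)) / 8"
    by (simp add: den_Suc field_simps eval_nat_numeral)
  also have "\<dots> \<le> 1 / (2 ^ k * real (den L)) / 8"
  proof -
    have "2 ^ k \<le> real (den j)"
      using le_trans [OF two_power_le_den [of k] den_mono [OF assms(1)]] by simp
    moreover have "real (den L) \<le> real (den j)"
      using den_mono [OF assms(2)] by simp
    ultimately have "2 ^ k * real (den L) \<le> real (den j) * real (den j)"
      by (intro mult_mono) auto
    then show ?thesis
      by (intro divide_right_mono divide_left_mono) auto
  qed
  finally show ?thesis by (simp add: power_one_over)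
qed

text \<open>Multiplying a tail by any \<open>b \<le> den L\<close> keeps it small, which is what makes it harmless to search for
a multiplier modulo \<open>den L\<close>. In the \<open>k\<close>-th chord only the part of the series beyond the index
\<open>max k L\<close> counts, since multiplication by \<open>den k\<close> turns the summands up to \<open>k\<close> into integers.\<close>

lemma lac_norm_mult_tail:
  assumes "b \<le> den L"
  shows "real b * tail L \<in> lac_set" and "lac_norm (real b * tail L) \<le> 4 / real (den L)"
proof -
  have "chord (real (den k) * (real b * tail L)) \<le> (1 / 2) ^ k * (2 / real (den L))" for k
  proof -
    \<comment> \<open>The summands of the tail up to index \<open>j\<close> vanish modulo \<open>1\<close> after multiplication by \<open>den k\<close>:
        there are none if \<open>k \<le> L\<close>, and \<open>j = k\<close> otherwise.\<close>
    define j where "j = max k L"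
    have "\<exists>m::int. tail L = of_int m / real (den k) + tail j"
    proof (cases "k \<le> L")
      case True
      then show ?thesis by (intro exI [of _ 0]) (simp add: j_def max_def)
    next
      case False
      then show ?thesis
        using tail_odd_numerator [of L k] by (auto simp: j_def max_def intro: exI [of _ "int _"])
    qed
    then obtain m :: int where m: "tail L = of_int m / real (den k) + tail j" by blast
    have "real (den k) * (real b * tail L) = real (den k) * real b * tail j + of_int (int b * m)"
      by (simp add: m field_simps)
    then have "chord (real (den k) * (real b * tail L)) = chord (real (den k) * real b * tail j)"
      by (simp only: chord_add_of_int)
    also have "\<dots> \<le> 7 * (real (den k) * real b * tail j)"
      using chord_le [of "real (den k) * real b * tail j"] tail_nonneg [of j] by (simp add: abs_mult)
    also have "\<dots> \<le> 7 * (real (den j) * real (den j) * (2 / real (den (Suc j))))"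
    proof -
      have "real b \<le> real (den j)" "real (den k) \<le> real (den j)"
        using assms den_mono [of L j] den_mono [of k j] by (auto simp: j_def)
      then show ?thesis
        by (intro mult_left_mono mult_mono tail_le tail_nonneg) auto
    qed
    also have "\<dots> = 14 * (real (den j) * (real (den j) / real (den (Suc j))))"
      by simp
    also have "\<dots> \<le> 14 * ((1 / 2) ^ k * (1 / real (den L)) / 8)"
      by (intro mult_left_mono lacunary_estimate) (auto simp: j_def)
    also have "\<dots> \<le> (1 / 2) ^ k * (2 / real (den L))"
      by (simp add: field_simps)
    finally show ?thesis .
  qed
  from lac_norm_le_geometric [OF this]
  show "real b * tail L \<in> lac_set" "lac_norm (real b * tail L) \<le> 4 / real (den L)"
    by simp_all
qed

lemma tail_in_lac_set: "tail M \<in> lac_set" and lac_norm_tail_le: "lac_norm (tail M) \<le> 4 / real (den M)"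
  using lac_norm_mult_tail [of 1 M] den_pos [of M] by (simp_all add: Suc_leI del: den_pos)

text \<open>Only finitely many of the chords are nonzero.\<close>

lemma dyadic_in_lac_set: "of_int a / real (den L) \<in> lac_set"
proof -
  have "chord (real (den (k + L)) * (of_int a / real (den L))) = 0" for k
  proof -
    obtain q where "den (k + L) = den L * q"
      using den_dvd [of L "k + L"] by (auto elim: dvdE)
    then have "real (den (k + L)) * (of_int a / real (den L)) = 0 + of_int (int q * a)"
      by simp
    then show ?thesis by (simp only: chord_add_of_int chord_0)
  qed
  then have "summable (\<lambda>k. chord (real (den (k + L)) * (of_int a / real (den L))))"
    by simp
  then show ?thesis
    unfolding lac_set_def using summable_iff_shift [where f = "\<lambda>k. chord (real (den k) * (of_int a / real (den L)))"]
    by blast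
qed

text \<open>When \<open>z\<close> is rounded to a fraction with denominator \<open>den (Suc L)\<close>, the chords of the error of index
beyond \<open>L\<close> are those of \<open>z\<close> itself, since the fraction becomes an integer there. Those of index at
most \<open>L\<close> are small because \<open>den (Suc L)\<close> is much larger than \<open>den L\<close>.\<close>

lemma dyadic_approximation:
  assumes z: "z \<in> lac_set"
  shows "lac_norm (z - of_int (round (real (den (Suc L)) * z)) / real (den (Suc L)))
         \<le> 2 / real (den L) + (\<Sum>k. chord (real (den (k + Suc L)) * z))"
proof -
  define a where "a = round (real (den (Suc L)) * z)"
  define y where "y = z - of_int a / real (den (Suc L))"
  have y: "y \<in> lac_set"
    unfolding y_def by (intro lac_set_diff z dyadic_in_lac_set)
  have head: "chord (real (den k) * y) \<le> (1 / 2) ^ k * (1 / real (den L))" if "k < Suc L" for k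
  proof -
    have "\<bar>y\<bar> = \<bar>of_int a - real (den (Suc L)) * z\<bar> / real (den (Suc L))"
      by (simp add: y_def field_simps abs_minus_commute)
    also have "\<dots> \<le> (1 / 2) / real (den (Suc L))"
      unfolding a_def by (intro divide_right_mono of_int_round_abs_le) simp
    finally have "7 * (real (den k) * \<bar>y\<bar>) \<le> 7 * (real (den k) * ((1 / 2) / real (den (Suc L))))"
      by (intro mult_left_mono) auto
    then have "chord (real (den k) * y) \<le> 7 * (real (den k) * ((1 / 2) / real (den (Suc L))))"
      using chord_le [of "real (den k) * y"] unfolding abs_mult abs_of_nat by (rule order_trans [rotated])
    also have "\<dots> \<le> 7 * (real (den L) * (real (den L) / real (den (Suc L))))"
      using that den_mono [of k L] den_ge_1 [of L]
      by (intro mult_left_mono mult_mono divide_right_mono) auto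
    also have "\<dots> \<le> 7 * ((1 / 2) ^ k * (1 / real (den L)) / 8)"
      using that by (intro mult_left_mono lacunary_estimate) auto
    also have "\<dots> \<le> (1 / 2) ^ k * (1 / real (den L))"
      by (simp add: field_simps)
    finally show ?thesis .
  qed
  have rest: "chord (real (den (k + Suc L)) * y) = chord (real (den (k + Suc L)) * z)" for k
  proof -
    obtain q where "den (k + Suc L) = den (Suc L) * q"
      using den_dvd [of "Suc L" "k + Suc L"] by (auto elim: dvdE)
    then have "real (den (k + Suc L)) * y = real (den (k + Suc L)) * z + of_int (- (int q * a))"
      by (simp add: y_def right_diff_distrib)
    then show ?thesis by (simp only: chord_add_of_int)
  qed
  have "lac_norm y = (\<Sum>k. chord (real (den (k + Suc L)) * y)) + (\<Sum>k<Suc L. chord (real (den k) * y))"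
    unfolding lac_norm_def by (rule suminf_split_initial_segment [OF lac_set_summable [OF y]])
  also have "(\<Sum>k<Suc L. chord (real (den k) * y)) \<le> (\<Sum>k<Suc L. (1 / 2) ^ k * (1 / real (den L)))"
    by (intro sum_mono head) auto
  also have "\<dots> \<le> 2 / real (den L)"
    using sum_le_suminf [OF geometric_summable [of "1 / real (den L)"], of "{..<Suc L}"]
    unfolding geometric_suminf by (simp del: sum.lessThan_Suc)
  finally show ?thesis unfolding rest unfolding y_def a_def by simp
qed

text \<open>Approximate \<open>z\<close> by a fraction \<open>a / n\<close>, write \<open>tail M\<close> as \<open>p / n\<close> plus a shorter tail with \<open>p\<close> odd,
and solve \<open>b p \<equiv> a\<close> modulo \<open>n\<close>.\<close>

lemma multiples_of_tail_dense:
  assumes z: "z \<in> lac_set" and "0 < \<epsilon>"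
  shows "\<exists>b::nat. lac_norm (real b * tail M - z) < \<epsilon>"
proof -
  \<comment> \<open>Rounding costs \<open>2 / den L + \<epsilon> / 2\<close> and the leftover tail at most \<open>4 / den L\<close>.\<close>
  have "\<forall>\<^sub>F L in sequentially. 1 / real (den L) < \<epsilon> / 12"
    using inverse_den_tendsto_0 \<open>0 < \<epsilon>\<close> by (intro order_tendstoD(2)) auto
  moreover obtain N where N: "\<And>n. n \<ge> N \<Longrightarrow> norm (\<Sum>k. chord (real (den (k + n)) * z)) < \<epsilon> / 2"
    using suminf_exist_split [OF _ lac_set_summable [OF z], of "\<epsilon> / 2"] \<open>0 < \<epsilon>\<close> by auto
  ultimately obtain L where L: "1 / real (den L) < \<epsilon> / 12" "M \<le> L" "N \<le> L"
    by (metis (no_types, lifting) eventually_sequentially nle_le order.trans)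
  define n where "n = den (Suc L)"
  define a where "a = round (real n * z)"
  have approx: "lac_norm (z - of_int a / real n) < 2 / real (den L) + \<epsilon> / 2"
    using dyadic_approximation [OF z, of L] N [of "Suc L"] L by (simp add: a_def n_def)
  obtain p where p: "odd p" "tail M = real p / real n + tail (Suc L)"
    using tail_odd_numerator [of M "Suc L"] L unfolding n_def by auto
  have "coprime (int p) (int n)"
    using p(1) by (simp add: n_def den_def)
  then obtain c where c: "[int p * c = 1] (mod int n)"
    using cong_solve_coprime_int by blast
  define b where "b = nat ((c * a) mod int n)"
  have n0: "0 < n" by (simp add: n_def)
  have b_int: "int b = (c * a) mod int n" using n0 by (simp add: b_def)
  have "b \<le> n"
    using n0 by (simp add: b_def nat_le_iff less_imp_le)
  have "[int b * int p = a] (mod int n)"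
  proof -
    have "[int b * int p = (c * a) * int p] (mod int n)"
      unfolding b_int by (simp add: cong_def mod_mult_left_eq)
    also have "(c * a) * int p = (int p * c) * a" by simp
    also have "[(int p * c) * a = 1 * a] (mod int n)"
      by (intro cong_scalar_right c)
    finally show ?thesis by simp
  qed
  then obtain m where "int b * int p = a + int n * m"
    by (metis cong_iff_lin cong_sym)
  then have m: "real b * real p = of_int a + real n * of_int m"
    by (metis of_int_add of_int_mult of_int_of_nat_eq)
  have "real b * tail M - z = (real b * tail (Suc L) + - (z - of_int a / real n)) + of_int m"
  proof -
    have "real b * tail M = (real b * real p) / real n + real b * tail (Suc L)"
      unfolding p(2) by (simp add: distrib_left)
    also have "\<dots> = of_int a / real n + of_int m + real b * tail (Suc L)"
      unfolding m using n0 by (simp add: field_simps)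
    finally show ?thesis by simp
  qed
  then have "lac_norm (real b * tail M - z)
      = lac_norm (real b * tail (Suc L) + - (z - of_int a / real n))"
    by (simp only: lac_norm_add_of_int)
  also have "\<dots> \<le> lac_norm (real b * tail (Suc L)) + lac_norm (- (z - of_int a / real n))"
  proof (rule lac_set_add(2))
    show "real b * tail (Suc L) \<in> lac_set"
      using lac_norm_mult_tail(1) \<open>b \<le> n\<close> by (simp add: n_def)
    show "- (z - of_int a / real n) \<in> lac_set"
      unfolding lac_set_minus n_def by (intro lac_set_diff z dyadic_in_lac_set)
  qed
  also have "\<dots> < 4 / real n + (2 / real (den L) + \<epsilon> / 2)"
    using lac_norm_mult_tail(2) [of b "Suc L"] \<open>b \<le> n\<close> approx unfolding lac_norm_minus n_def by linarith
  also have "\<dots> \<le> 4 / real (den L) + (2 / real (den L) + \<epsilon> / 2)"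
    using den_mono [of L "Suc L"] by (intro add_right_mono divide_left_mono) (auto simp: n_def)
  also have "\<dots> < \<epsilon>"
    using L(1) by simp
  finally show ?thesis ..
qed


section \<open>Groups with an invariant metric\<close>

text \<open>Invariance makes multiplication Lipschitz in both arguments together and inversion an isometry.\<close>

lemma topological_group_if_invariant_metric:
  assumes "comm_group G" and "Metric_space (carrier G) d"
    and invariant: "\<And>x y z. \<lbrakk>x \<in> carrier G; y \<in> carrier G; z \<in> carrier G\<rbrakk>
          \<Longrightarrow> d (z \<otimes>\<^bsub>G\<^esub> x) (z \<otimes>\<^bsub>G\<^esub> y) = d x y"
  shows "topological_group G (Metric_space.mtopology (carrier G) d)"
proof -
  interpret comm_group G by fact
  interpret Metric_space "carrier G" d by fact
  have mult: "d (x \<otimes>\<^bsub>G\<^esub> y) (x' \<otimes>\<^bsub>G\<^esub> y') \<le> d x x' + d y y'"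
    if "x \<in> carrier G" "y \<in> carrier G" "x' \<in> carrier G" "y' \<in> carrier G" for x y x' y'
  proof -
    have "d (x \<otimes>\<^bsub>G\<^esub> y) (x' \<otimes>\<^bsub>G\<^esub> y') \<le> d (x \<otimes>\<^bsub>G\<^esub> y) (x' \<otimes>\<^bsub>G\<^esub> y) + d (x' \<otimes>\<^bsub>G\<^esub> y) (x' \<otimes>\<^bsub>G\<^esub> y')"
      using that by (intro triangle) auto
    also have "d (x \<otimes>\<^bsub>G\<^esub> y) (x' \<otimes>\<^bsub>G\<^esub> y) = d x x'"
      using invariant [of x x' y] that by (simp add: m_comm)
    finally show ?thesis using invariant that by simp
  qed
  have inv: "d (inv\<^bsub>G\<^esub> x) (inv\<^bsub>G\<^esub> y) = d x y" if "x \<in> carrier G" "y \<in> carrier G" for x y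
  proof -
    have "(x \<otimes>\<^bsub>G\<^esub> y) \<otimes>\<^bsub>G\<^esub> inv\<^bsub>G\<^esub> y = x"
      using that by (simp add: m_assoc)
    moreover have "(x \<otimes>\<^bsub>G\<^esub> y) \<otimes>\<^bsub>G\<^esub> inv\<^bsub>G\<^esub> x = y"
      using that by (subst m_comm [of x y]) (simp_all add: m_assoc)
    ultimately show ?thesis
      using invariant [of "inv\<^bsub>G\<^esub> x" "inv\<^bsub>G\<^esub> y" "x \<otimes>\<^bsub>G\<^esub> y"] that commute [of x y]
      by simp
  qed
  show ?thesis
  proof
    show "topspace mtopology = carrier G" by simp
    show "continuous_map (prod_topology mtopology mtopology) mtopology (\<lambda>(x, y). x \<otimes>\<^bsub>G\<^esub> y)"
      unfolding continuous_map_to_metric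
    proof (intro ballI allI impI)
      fix p and \<epsilon> :: real
      assume "p \<in> topspace (prod_topology mtopology mtopology)" "0 < \<epsilon>"
      then obtain x y where p: "p = (x, y)" "x \<in> carrier G" "y \<in> carrier G" by auto
      let ?U = "mball x (\<epsilon> / 2) \<times> mball y (\<epsilon> / 2)"
      have "(case q of (x, y) \<Rightarrow> x \<otimes>\<^bsub>G\<^esub> y) \<in> mball (case p of (x, y) \<Rightarrow> x \<otimes>\<^bsub>G\<^esub> y) \<epsilon>"
        if "q \<in> ?U" for q
        using that p mult [of x y "fst q" "snd q"] by (auto simp: split_beta)
      moreover have "p \<in> ?U" using p \<open>0 < \<epsilon>\<close> by simp
      moreover have "openin (prod_topology mtopology mtopology) ?U"
        by (simp add: openin_prod_Times_iff)
      ultimately show "\<exists>U. openin (prod_topology mtopology mtopology) U \<and> p \<in> U \<and>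
          (\<forall>q\<in>U. (case q of (x, y) \<Rightarrow> x \<otimes>\<^bsub>G\<^esub> y) \<in> mball (case p of (x, y) \<Rightarrow> x \<otimes>\<^bsub>G\<^esub> y) \<epsilon>)"
        by blast
    qed
    show "continuous_map mtopology mtopology (\<lambda>x. inv\<^bsub>G\<^esub> x)"
      unfolding metric_continuous_map [OF Metric_space_axioms] using inv by auto
  qed
qed

section \<open>The group and its topology\<close>

text \<open>Residue classes modulo \<open>1\<close> are represented by their elements in the interval \<open>[0, 1)\<close>.\<close>

definition lac_group :: "real monoid" where
  "lac_group = \<lparr>carrier = {x \<in> lac_set. 0 \<le> x \<and> x < 1}, mult = (\<lambda>x y. frac (x + y)), one = 0\<rparr>"

text \<open>A metric is nonnegative on the whole type, but \<^const>\<open>lac_norm\<close> has an unspecified value where the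
series diverges; hence the absolute value.\<close>

definition lac_dist :: "real \<Rightarrow> real \<Rightarrow> real" where
  "lac_dist x y = \<bar>lac_norm (x - y)\<bar>"

lemma lac_dist_eq: "x - y \<in> lac_set \<Longrightarrow> lac_dist x y = lac_norm (x - y)"
  by (simp add: lac_dist_def lac_norm_nonneg)

lemma carrier_lac_group: "x \<in> carrier lac_group \<longleftrightarrow> x \<in> lac_set \<and> 0 \<le> x \<and> x < 1"
  by (simp add: lac_group_def)

lemma one_lac_group [simp]: "\<one>\<^bsub>lac_group\<^esub> = 0"
  by (simp add: lac_group_def)

lemma mult_lac_group: "x \<otimes>\<^bsub>lac_group\<^esub> y = frac (x + y)"
  by (simp add: lac_group_def)

lemma frac_conv_add_of_int: "frac x = x + of_int (- \<lfloor>x\<rfloor>)"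
  by (simp add: frac_def)

lemma frac_in_lac_group [simp]: "frac x \<in> carrier lac_group \<longleftrightarrow> x \<in> lac_set"
  unfolding carrier_lac_group by (metis frac_conv_add_of_int frac_ge_0 frac_lt_1 lac_set_add_of_int)

lemma frac_eq_if_diff_Ints:
  fixes x y :: real
  assumes "x - y \<in> \<int>" shows "frac x = frac y"
proof -
  from assms obtain m where "x = y + of_int m"
    by (metis Ints_cases diff_add_cancel add.commute)
  then show ?thesis by (simp add: frac_def)
qed

lemma frac_add_frac: "frac (x + frac y) = frac (x + (y :: real))" "frac (frac x + y) = frac (x + y)"
  by (rule frac_eq_if_diff_Ints; simp add: frac_def)+

lemma lac_dist_frac: "lac_dist (frac x) (frac y) = \<bar>lac_norm (x - y)\<bar>"
proof -
  have "frac x - frac y = (x - y) + of_int (\<lfloor>y\<rfloor> - \<lfloor>x\<rfloor>)"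
    by (simp add: frac_def)
  then show ?thesis unfolding lac_dist_def by (simp only: lac_norm_add_of_int)
qed

lemma frac_lac_group: "x \<in> carrier lac_group \<Longrightarrow> frac x = x"
  by (simp add: carrier_lac_group frac_eq)

lemma comm_group_lac_group: "comm_group lac_group"
proof (rule comm_groupI)
  fix x assume x: "x \<in> carrier lac_group"
  then have "frac (- x) \<in> carrier lac_group"
    by (simp add: carrier_lac_group [of x])
  moreover have "frac (- x) \<otimes>\<^bsub>lac_group\<^esub> x = \<one>\<^bsub>lac_group\<^esub>"
    by (simp add: mult_lac_group frac_add_frac)
  ultimately show "\<exists>y\<in>carrier lac_group. y \<otimes>\<^bsub>lac_group\<^esub> x = \<one>\<^bsub>lac_group\<^esub>" ..
next
  show "\<one>\<^bsub>lac_group\<^esub> \<in> carrier lac_group"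
    using lac_set_of_int [of 0] by (simp add: carrier_lac_group)
next
  fix x y assume "x \<in> carrier lac_group" "y \<in> carrier lac_group"
  then show "x \<otimes>\<^bsub>lac_group\<^esub> y \<in> carrier lac_group"
    unfolding mult_lac_group frac_in_lac_group by (simp add: carrier_lac_group lac_set_add(1))
next
  fix x y
  show "x \<otimes>\<^bsub>lac_group\<^esub> y = y \<otimes>\<^bsub>lac_group\<^esub> x"
    by (simp add: mult_lac_group add.commute)
next
  fix x y z
  show "x \<otimes>\<^bsub>lac_group\<^esub> y \<otimes>\<^bsub>lac_group\<^esub> z = x \<otimes>\<^bsub>lac_group\<^esub> (y \<otimes>\<^bsub>lac_group\<^esub> z)"
    unfolding mult_lac_group frac_add_frac by (simp add: add.assoc)
next
  fix x assume "x \<in> carrier lac_group"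
  then show "\<one>\<^bsub>lac_group\<^esub> \<otimes>\<^bsub>lac_group\<^esub> x = x"
    by (simp add: mult_lac_group frac_lac_group)
qed

lemma Metric_space_lac_group: "Metric_space (carrier lac_group) lac_dist"
proof
  fix x y
  show "lac_dist x y = lac_dist y x"
    using lac_norm_minus [of "x - y"] by (simp add: lac_dist_def)
  show "0 \<le> lac_dist x y"
    by (simp add: lac_dist_def)
  show "lac_dist x y = 0 \<longleftrightarrow> x = y" if "x \<in> carrier lac_group" "y \<in> carrier lac_group"
  proof -
    have "lac_dist x y = 0 \<longleftrightarrow> x - y \<in> \<int>"
      using that by (simp add: lac_dist_def carrier_lac_group lac_norm_eq_0_iff lac_set_diff)
    also have "\<dots> \<longleftrightarrow> x = y"
      using that frac_eq_if_diff_Ints [of x y] by (auto simp: frac_lac_group)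
    finally show ?thesis .
  qed
  fix z
  assume "x \<in> carrier lac_group" "y \<in> carrier lac_group" "z \<in> carrier lac_group"
  then show "lac_dist x z \<le> lac_dist x y + lac_dist y z"
    using lac_set_add(2) [of "x - y" "y - z"] by (simp add: lac_dist_eq carrier_lac_group lac_set_diff)
qed


interpretation lac: Metric_space "carrier lac_group" lac_dist
  by (rule Metric_space_lac_group)

lemma topological_group_lac: "topological_group lac_group lac.mtopology"
proof (rule topological_group_if_invariant_metric [OF comm_group_lac_group Metric_space_lac_group])
  fix x y z
  assume "x \<in> carrier lac_group" "y \<in> carrier lac_group"
  then show "lac_dist (z \<otimes>\<^bsub>lac_group\<^esub> x) (z \<otimes>\<^bsub>lac_group\<^esub> y) = lac_dist x y"
    unfolding mult_lac_group lac_dist_frac by (simp add: lac_dist_def)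
qed

text \<open>A Cauchy sequence converges on the circle, to \<open>e(x)\<close> say. Each partial sum of the norm involves only
finitely many powers of points of the circle, so a bound on the partial sums of \<open>\<sigma> i - \<sigma> j\<close> passes
to the limit in \<open>j\<close>. It then holds for the whole series of \<open>\<sigma> i - x\<close>, which puts \<open>x\<close> into the group
and shows convergence in the finer metric.\<close>

lemma mcomplete_lac: "lac.mcomplete"
  unfolding lac.mcomplete_def
proof (intro allI impI)
  fix \<sigma> assume "lac.MCauchy \<sigma>"
  then have range: "range \<sigma> \<subseteq> carrier lac_group"
    and MCauchy: "\<forall>\<epsilon>>0. \<exists>N. \<forall>n n'. N \<le> n \<longrightarrow> N \<le> n' \<longrightarrow> lac_dist (\<sigma> n) (\<sigma> n') < \<epsilon>"
    unfolding lac.MCauchy_def by (rule conjunct1, rule conjunct2)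
  have \<sigma>: "\<sigma> i \<in> carrier lac_group" for i
    using range by (rule subsetD) simp
  have Cauchy: "\<exists>N. \<forall>i\<ge>N. \<forall>j\<ge>N. lac_dist (\<sigma> i) (\<sigma> j) < \<epsilon>" if "0 < \<epsilon>" for \<epsilon>
    using MCauchy that by meson
  have diff: "\<sigma> i - \<sigma> j \<in> lac_set" for i j
    using \<sigma> by (simp add: carrier_lac_group lac_set_diff)
  have "Cauchy (\<lambda>i. circle_point (\<sigma> i))"
  proof (rule metric_CauchyI)
    fix \<epsilon> :: real assume "0 < \<epsilon>"
    then obtain N where N: "\<forall>i\<ge>N. \<forall>j\<ge>N. lac_dist (\<sigma> i) (\<sigma> j) < \<epsilon>"
      using Cauchy by blast
    have "dist (circle_point (\<sigma> i)) (circle_point (\<sigma> j)) \<le> lac_dist (\<sigma> i) (\<sigma> j)" for i j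
      using chord_le_lac_norm [OF diff] by (simp add: dist_norm lac_dist_eq diff flip: chord_diff)
    then show "\<exists>N. \<forall>i\<ge>N. \<forall>j\<ge>N. dist (circle_point (\<sigma> i)) (circle_point (\<sigma> j)) < \<epsilon>"
      using N by (meson le_less_trans)
  qed
  then obtain z where z: "(\<lambda>i. circle_point (\<sigma> i)) \<longlonglongrightarrow> z"
    using Cauchy_convergent convergent_def by blast
  have "cmod z = 1"
    using tendsto_norm [OF z] by (simp add: LIMSEQ_const_iff)
  define x where "x = Arg z / (2 * pi)"
  have "z \<noteq> 0"
    using \<open>cmod z = 1\<close> by auto
  with \<open>cmod z = 1\<close> have x: "circle_point x = z"
    using cis_Arg [of z] by (simp add: x_def circle_point_def sgn_div_norm)
  have close: "\<sigma> i - x \<in> lac_set \<and> lac_norm (\<sigma> i - x) \<le> \<epsilon>"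
    if N: "\<forall>i\<ge>N. \<forall>j\<ge>N. lac_dist (\<sigma> i) (\<sigma> j) < \<epsilon>" and i: "N \<le> i" for N i \<epsilon>
  proof -
    have chord_pow: "chord (real (den k) * (\<sigma> i - y)) =
        cmod (circle_point (\<sigma> i) ^ den k - circle_point y ^ den k)" for k y
      by (simp add: right_diff_distrib chord_diff circle_point_of_nat_mult)
    have bound: "(\<Sum>k<n. chord (real (den k) * (\<sigma> i - x))) \<le> \<epsilon>" for n
    proof (rule LIMSEQ_le_const2)
      show "(\<lambda>j. \<Sum>k<n. chord (real (den k) * (\<sigma> i - \<sigma> j))) \<longlonglongrightarrow> (\<Sum>k<n. chord (real (den k) * (\<sigma> i - x)))"
        unfolding chord_pow x by (intro tendsto_intros z)
      have "(\<Sum>k<n. chord (real (den k) * (\<sigma> i - \<sigma> j))) \<le> \<epsilon>" if "N \<le> j" for j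
      proof -
        have "(\<Sum>k<n. chord (real (den k) * (\<sigma> i - \<sigma> j))) \<le> lac_norm (\<sigma> i - \<sigma> j)"
          unfolding lac_norm_def by (intro sum_le_suminf lac_set_summable diff) auto
        also have "\<dots> < \<epsilon>"
          using N i that by (simp flip: lac_dist_eq [OF diff])
        finally show ?thesis by simp
      qed
      then show "\<exists>N. \<forall>j\<ge>N. (\<Sum>k<n. chord (real (den k) * (\<sigma> i - \<sigma> j))) \<le> \<epsilon>"
        by blast
    qed
    have "summable (\<lambda>k. chord (real (den k) * (\<sigma> i - x)))"
      by (rule summableI_nonneg_bounded [OF chord_nonneg bound])
    then show ?thesis
      using suminf_le_const [OF _ bound] by (simp add: lac_set_def lac_norm_def)
  qed
  obtain N where "\<forall>i\<ge>N. \<forall>j\<ge>N. lac_dist (\<sigma> i) (\<sigma> j) < 1"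
    using Cauchy [of 1] by auto
  from close [OF this order_refl] have "\<sigma> N - (\<sigma> N - x) \<in> lac_set"
    using \<sigma> [of N] by (simp only: lac_set_diff carrier_lac_group)
  then have "frac x \<in> carrier lac_group" by simp
  moreover have "\<forall>\<^sub>F i in sequentially. \<sigma> i \<in> carrier lac_group \<and> lac_dist (\<sigma> i) (frac x) < \<epsilon>"
    if "0 < \<epsilon>" for \<epsilon>
  proof -
    obtain N where N: "\<forall>i\<ge>N. \<forall>j\<ge>N. lac_dist (\<sigma> i) (\<sigma> j) < \<epsilon> / 2"
      using Cauchy [OF half_gt_zero [OF \<open>0 < \<epsilon>\<close>]] by blast
    have "lac_dist (\<sigma> i) (frac x) < \<epsilon>" if "N \<le> i" for i
      using close [OF N that] lac_dist_frac [of "\<sigma> i" x] \<open>0 < \<epsilon>\<close>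
      by (simp add: frac_lac_group \<sigma> lac_norm_nonneg)
    then show ?thesis
      using \<sigma> by (auto simp: eventually_sequentially)
  qed
  ultimately have "limitin lac.mtopology \<sigma> (frac x) sequentially"
    by (simp add: lac.limitin_metric)
  then show "\<exists>x. limitin lac.mtopology \<sigma> x sequentially" ..
qed

section \<open>Infinitesimal rank\<close>

lemma closure_of_multiples_of_tail:
  "lac.mtopology closure_of (range (\<lambda>b::nat. frac (real b * tail M))) = topspace lac.mtopology"
proof -
  have "\<exists>b::nat. frac (real b * tail M) \<in> lac.mball z r"
    if z: "z \<in> carrier lac_group" and "0 < r" for z r
  proof -
    obtain b :: nat where b: "lac_norm (real b * tail M - z) < r"
      using multiples_of_tail_dense [of z r M] z \<open>0 < r\<close> by (auto simp: carrier_lac_group)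
    have "real b * tail M \<in> lac_set"
      by (intro lac_set_of_nat_mult tail_in_lac_set)
    moreover have "lac_dist (frac (real b * tail M)) (frac z) = lac_norm (real b * tail M - z)"
      unfolding lac_dist_frac using calculation z
      by (simp add: carrier_lac_group lac_norm_nonneg lac_set_diff)
    ultimately show ?thesis
      using b z by (intro exI [of _ b]) (simp add: frac_lac_group lac.commute)
  qed
  then show ?thesis
    unfolding lac.metric_closure_of by auto
qed

lemma polish_group_lac: "polish_group lac_group lac.mtopology"
proof -
  interpret topological_group lac_group lac.mtopology
    by (rule topological_group_lac)
  show ?thesis
  proof
    show "separable_space lac.mtopology"
      unfolding separable_space_def
    proof (intro exI conjI)
      show "range (\<lambda>b::nat. frac (real b * tail 0)) \<subseteq> topspace lac.mtopology"
        using lac_set_of_nat_mult [OF tail_in_lac_set] by auto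
    qed (simp_all only: closure_of_multiples_of_tail countable_image [OF countableI_type])
    show "completely_metrizable_space lac.mtopology"
      unfolding completely_metrizable_space_def
      using lac.Metric_space_axioms mcomplete_lac by blast
  qed
qed

lemma multiple_in_generate: "frac (real b * x) \<in> generate lac_group {frac x}"
proof (induction b)
  case 0
  then show ?case using generate.one [of lac_group "{frac x}"] by simp
next
  case (Suc b)
  have "frac (real (Suc b) * x) = frac (real b * x) \<otimes>\<^bsub>lac_group\<^esub> frac x"
    by (simp add: mult_lac_group frac_add_frac distrib_right add.commute)
  then show ?case
    using generate.eng [OF Suc generate.incl] by simp
qed

lemma generate_tail_dense:
  "lac.mtopology closure_of (generate lac_group {frac (tail M)}) = topspace lac.mtopology"
proof -
  have "range (\<lambda>b::nat. frac (real b * tail M)) \<subseteq> generate lac_group {frac (tail M)}"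
    using multiple_in_generate by blast
  then show ?thesis
    using closure_of_mono closure_of_multiples_of_tail closure_of_subset_topspace by (metis subset_antisym)
qed

lemma small_topological_generators_1: "small_topological_generators lac_group lac.mtopology 1"
  unfolding small_topological_generators_def
proof (intro allI impI)
  fix U assume "U \<subseteq> topspace lac.mtopology \<and> \<one>\<^bsub>lac_group\<^esub> \<in> lac.mtopology interior_of U"
  then have "0 \<in> lac.mtopology interior_of U" by simp
  then obtain r where "0 < r" "lac.mball 0 r \<subseteq> lac.mtopology interior_of U"
    using openin_interior_of [of lac.mtopology U] unfolding lac.openin_mtopology by blast
  then have r: "0 < r" "lac.mball 0 r \<subseteq> U"
    using interior_of_subset [of lac.mtopology U] by auto
  have "\<forall>\<^sub>F M in sequentially. 1 / real (den M) < r / 4"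
    using inverse_den_tendsto_0 r by (intro order_tendstoD(2)) auto
  then obtain M where M: "1 / real (den M) < r / 4"
    by (meson eventually_sequentially order_refl)
  have "lac_dist 0 (frac (tail M)) < r"
  proof -
    have "lac_dist (frac (tail M)) (frac 0) = lac_norm (tail M)"
      unfolding lac_dist_frac by (simp add: lac_norm_nonneg tail_in_lac_set)
    then show ?thesis
      using lac_norm_tail_le [of M] M by (simp add: lac.commute)
  qed
  then have "frac (tail M) \<in> U"
    using r lac_set_of_int [of 0] by (auto simp: tail_in_lac_set carrier_lac_group [of 0])
  moreover have "{i. enat i < 1} = {0}"
    by (auto simp: one_enat_def)
  ultimately show "\<exists>g :: nat \<Rightarrow> real. g ` {i. enat i < 1} \<subseteq> U \<and>
      lac.mtopology closure_of generate lac_group (g ` {i. enat i < 1}) = topspace lac.mtopology"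
    using generate_tail_dense by (intro exI [of _ "\<lambda>_. frac (tail M)"]) simp
qed

text \<open>The empty tuple generates the trivial subgroup, which is closed and does not contain \<open>1/2\<close>.\<close>

lemma not_small_topological_generators_0: "\<not> small_topological_generators lac_group lac.mtopology 0"
proof
  interpret group lac_group
    by (rule comm_group.axioms(2) [OF comm_group_lac_group])
  have half: "1 / 2 \<in> carrier lac_group"
    using dyadic_in_lac_set [of 4 1] den_Suc [of 0] by (simp add: carrier_lac_group)
  have zero: "0 \<in> carrier lac_group"
    using one_closed by simp
  assume "small_topological_generators lac_group lac.mtopology 0"
  moreover have "\<one>\<^bsub>lac_group\<^esub> \<in> lac.mtopology interior_of (topspace lac.mtopology)"
    unfolding interior_of_topspace using zero by simp
  ultimately have "lac.mtopology closure_of (generate lac_group {}) = topspace lac.mtopology"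
    unfolding small_topological_generators_def by (auto dest!: spec [of _ "topspace lac.mtopology"])
  then have "1 / 2 \<in> lac.mtopology closure_of {0}"
    using half by (simp add: generate_empty)
  moreover have "0 < lac_dist (1 / 2) 0"
    using lac.zero [OF half zero] lac.nonneg [of "1 / 2" 0] by linarith
  ultimately have "lac_dist (1 / 2) 0 < lac_dist (1 / 2) 0"
    unfolding lac.metric_closure_of by fastforce
  then show False by simp
qed

lemma infinitesimal_rank_lac: "infinitesimal_rank lac_group lac.mtopology = 1"
  unfolding infinitesimal_rank_def
proof (rule antisym)
  show "Inf {n. small_topological_generators lac_group lac.mtopology n} \<le> 1"
    by (rule Inf_lower) (simp add: small_topological_generators_1)
  show "1 \<le> Inf {n. small_topological_generators lac_group lac.mtopology n}"
    using not_small_topological_generators_0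
    by (intro Inf_greatest) (metis ileI1 mem_Collect_eq not_gr_zero one_eSuc)
qed

section \<open>Total disconnectedness\<close>

lemma Re_circle_point_double: "Re (circle_point (2 * x)) = 2 * (Re (circle_point x))\<^sup>2 - 1"
  using cos_double_cos [of "2 * pi * x"] by (simp add: circle_point_def mult_ac)

text \<open>By the formula \<open>cos (2 t) = 2 (cos t)\<^sup>2 - 1\<close>, doubling takes the real part \<open>1/2\<close> to \<open>-1/2\<close>, which is
then fixed. So all chords but the first have length at least \<open>3/2\<close>.\<close>

lemma not_lac_set_if_Re_half:
  assumes "Re (circle_point x) = 1 / 2"
  shows "x \<notin> lac_set"
proof
  have Re: "Re (circle_point (2 ^ Suc i * x)) = - 1 / 2" for i
  proof (induction i)
    case 0
    then show ?case using Re_circle_point_double [of x] assms by (simp add: power2_eq_square)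
  next
    case (Suc i)
    then show ?case
      using Re_circle_point_double [of "2 ^ Suc i * x"] by (simp add: power2_eq_square mult.assoc)
  qed
  have far: "3 / 2 \<le> chord (real (den (Suc k)) * x)" for k
  proof -
    have "(4::nat) ^ Suc k - 1 = Suc (4 ^ Suc k - 2)"
      using one_le_power [of "4 :: nat" k] unfolding power_Suc by linarith
    then have "Re (circle_point (real (den (Suc k)) * x)) = - 1 / 2"
      using Re [of "4 ^ Suc k - 2"] by (simp only: den_def of_nat_power of_nat_numeral)
    then show ?thesis
      using abs_Re_le_cmod [of "circle_point (real (den (Suc k)) * x) - 1"] by (simp add: chord_def)
  qed
  assume "x \<in> lac_set"
  then have "(\<lambda>k. chord (real (den (Suc k)) * x)) \<longlonglongrightarrow> 0"
    using summable_LIMSEQ_zero [OF lac_set_summable] LIMSEQ_Suc by blast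
  then show False
    using LIMSEQ_le_const [of _ 0 "3 / 2"] far by fastforce
qed

text \<open>As long as the real part stays at least \<open>1/2\<close>, its distance to \<open>1\<close> at least doubles at each step, and
this cannot go on forever.\<close>

lemma doubling_leaves_arc:
  assumes "x \<notin> \<int>"
  shows "\<exists>j::nat. Re (circle_point (2 ^ j * x)) < 1 / 2"
proof (rule ccontr)
  assume "\<not> ?thesis"
  then have half: "1 / 2 \<le> Re (circle_point (2 ^ j * x))" for j
    by (simp add: not_less)
  have grow: "2 ^ j * (1 - Re (circle_point x)) \<le> 1 - Re (circle_point (2 ^ j * x))" for j
  proof (induction j)
    case (Suc j)
    let ?r = "Re (circle_point (2 ^ j * x))"
    have "?r \<le> 1"
      using complex_Re_le_cmod [of "circle_point (2 ^ j * x)"] by simp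
    then have "0 \<le> (1 - ?r) * ?r"
      using half [of j] by simp
    then have "2 * (1 - ?r) \<le> 1 - (2 * ?r\<^sup>2 - 1)"
      by (simp add: power2_eq_square algebra_simps)
    then show ?case
      using Suc Re_circle_point_double [of "2 ^ j * x"] by (simp add: mult.assoc)
  qed simp
  have "Re (circle_point x) < 1"
  proof (rule ccontr)
    assume "\<not> ?thesis"
    then have "cos (2 * pi * x) = 1"
      using cos_le_one [of "2 * pi * x"] by (simp add: circle_point_def)
    then obtain m :: int where "2 * pi * x = of_int m * 2 * pi"
      using cos_one_2pi_int by blast
    with assms show False by simp
  qed
  then obtain j where "1 / (1 - Re (circle_point x)) < 2 ^ j"
    using real_arch_pow [of 2] by auto
  then have "1 < 2 ^ j * (1 - Re (circle_point x))"
    using \<open>Re (circle_point x) < 1\<close> by (simp add: field_simps)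
  with grow [of j] half [of j] show False by simp
qed

lemma continuous_map_circle_point: "continuous_map lac.mtopology euclidean circle_point"
proof -
  have "cmod (circle_point x - circle_point y) \<le> lac_dist x y"
    if "x \<in> carrier lac_group" "y \<in> carrier lac_group" for x y
    using that chord_le_lac_norm [of "x - y"]
    by (simp add: carrier_lac_group lac_dist_eq lac_set_diff flip: chord_diff)
  then have "continuous_map lac.mtopology Met_TC.mtopology circle_point"
    unfolding lac.metric_continuous_map [OF Met_TC.Metric_space_axioms]
    by (auto simp: dist_norm intro: le_less_trans)
  then show ?thesis by simp
qed

text \<open>The function \<open>h\<close> below is continuous on the group and omits the value \<open>1/2\<close>, so its values on a
connected set all lie on the same side of \<open>1/2\<close>.\<close>

lemma totally_disconnected_lac: "totally_disconnected_topology lac.mtopology"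
  unfolding totally_disconnected_topology_def
proof
  fix C assume C: "C \<in> connected_components_of lac.mtopology"
  then obtain x where "x \<in> C"
    using nonempty_connected_components_of by blast
  have sub: "C \<subseteq> carrier lac_group"
    using connected_components_of_subset [OF C] by simp
  have "y = x" if "y \<in> C" for y
  proof (rule ccontr)
    assume "y \<noteq> x"
    then have "y - x \<notin> \<int>"
      using frac_eq_if_diff_Ints [of y x] sub \<open>x \<in> C\<close> \<open>y \<in> C\<close> frac_lac_group by (metis subsetD)
    then obtain j :: nat where j: "Re (circle_point (2 ^ j * (y - x))) < 1 / 2"
      using doubling_leaves_arc by blast
    define h where "h = (\<lambda>t. Re (circle_point (2 ^ j * (t - x))))"
    have "h = (\<lambda>w. Re ((w / circle_point x) ^ (2 ^ j))) \<circ> circle_point"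
    proof
      fix t
      have "circle_point t = circle_point (t - x) * circle_point x"
        by (simp flip: circle_point_add)
      moreover have "circle_point x \<noteq> 0"
        using norm_circle_point [of x] by force
      ultimately have "circle_point (t - x) = circle_point t / circle_point x"
        by simp
      then show "h t = ((\<lambda>w. Re ((w / circle_point x) ^ (2 ^ j))) \<circ> circle_point) t"
        using circle_point_of_nat_mult [of "2 ^ j" "t - x"] by (simp add: h_def)
    qed
    moreover have "continuous_map euclidean euclidean (\<lambda>w. Re ((w / circle_point x) ^ (2 ^ j)))"
      unfolding continuous_map_iff_continuous2 divide_inverse by (intro continuous_intros)
    ultimately have "continuous_map lac.mtopology euclidean h"
      using continuous_map_compose [OF continuous_map_circle_point] by metis
    then have "connectedin euclidean (h ` C)"
      by (rule connectedin_continuous_map_image [OF _ connectedin_connected_components_of [OF C]])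
    then have "connected (h ` C)"
      by (simp add: connectedin_iff_connected)
    moreover have "h y < 1 / 2" "h x = 1"
      using j by (simp_all add: h_def)
    ultimately have "1 / 2 \<in> h ` C"
      using \<open>x \<in> C\<close> \<open>y \<in> C\<close> connectedD_interval [of "h ` C" "h y" "h x" "1 / 2"] by auto
    then obtain w where "w \<in> C" and w: "Re (circle_point (2 ^ j * (w - x))) = 1 / 2"
      by (auto simp: h_def)
    have "2 ^ j * (w - x) \<in> lac_set"
    proof -
      have "w \<in> lac_set" "x \<in> lac_set"
        using \<open>w \<in> C\<close> \<open>x \<in> C\<close> sub carrier_lac_group by blast+
      then show ?thesis
        using lac_set_of_nat_mult [OF lac_set_diff, of w x "2 ^ j"] by simp
    qed
    with not_lac_set_if_Re_half [OF w] show False ..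
  qed
  with \<open>x \<in> C\<close> have "C = {x}" by blast
  then show "\<exists>x. C = {x}" ..
qed

theorem theorem1p9:
  shows "\<exists>(G :: real monoid) (T :: real topology).
           polish_group G T \<and> infinitesimal_rank G T = 1 \<and> totally_disconnected_topology T"
  using polish_group_lac infinitesimal_rank_lac totally_disconnected_lac by blast

end
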